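(* The set $A$ has (two-dimensional) Lebesgue measure $0$. In particular, for Lebesgue almost every $(\alpha,\beta)\in U$ the map $T_{\alpha,\beta}$ is of finite type and aperiodic.
   Context: Let $U=\{(\alpha,\beta):0\le\beta\le\alpha\le1\}$, $L=\{(\alpha,\beta):0\le\alpha\le\beta+1\le1\}$, $R=U\cup L$, and let $U^\circ$ be the interior of $U$. For $(\alpha,\beta)\in U^\circ$ define $T_{\alpha,\beta}:[0,1)\to[0,1)$ by $T_{\alpha,\beta}(x)=x+\alpha$ for $x\in[0,1-\alpha)$, $x+\beta$ for $x\in[1-\alpha,1-\beta)$, and $x+\beta-1$ for $x\in[1-\beta,1)$. Put $\Omega_0=[0,1)$, $\Omega_n=T_{\alpha,\beta}(\Omega_{n-1})$. $T_{\alpha,\beta}$ is of finite type if $\Omega_n=\Omega_{n+1}$ for some $n$. It is aperiodic if it has no periodic points. The Gauss map $G:U^\circ\to R$ is $$G(\alpha,\beta)=\Big(\frac{\beta}{\alpha},\ \frac{\beta-1}{\alpha}+\Big\lfloor\frac1\alpha\Big\rfloor\Big),$$ and $A=\bigcap_{n\ge0}G^{-n}(U^\circ)$, i.e. the set of points all of whose iterates $G^n(\alpha,\beta)$, $n\ge0$, are defined and lie in $U^\circ$. *)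

theory Defs
  imports "HOL-Analysis.Analysis"
begin

definition U :: "(real \<times> real) set" where
  "U = {(\<alpha>, \<beta>). 0 \<le> \<beta> \<and> \<beta> \<le> \<alpha> \<and> \<alpha> \<le> 1}"

(* T \<alpha> \<beta> is meant for (\<alpha>, \<beta>) in interior U and arguments in [0,1), where the three
   branches are [0, 1 - \<alpha>), [1 - \<alpha>, 1 - \<beta>) and [1 - \<beta>, 1).  It is a total function in
   HOL, so orbits and images below always start in [0,1), which T \<alpha> \<beta> maps into itself. *)
definition T :: "real \<Rightarrow> real \<Rightarrow> real \<Rightarrow> real" where
  "T \<alpha> \<beta> x =
     (if x < 1 - \<alpha> then x + \<alpha>
      else if x < 1 - \<beta> then x + \<beta>
      else x + \<beta> - 1)"

primrec \<Omega> :: "real \<Rightarrow> real \<Rightarrow> nat \<Rightarrow> real set" where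
  "\<Omega> \<alpha> \<beta> 0 = {0..<1}"
| "\<Omega> \<alpha> \<beta> (Suc n) = T \<alpha> \<beta> ` \<Omega> \<alpha> \<beta> n"

definition finite_type :: "real \<Rightarrow> real \<Rightarrow> bool" where
  "finite_type \<alpha> \<beta> \<longleftrightarrow> (\<exists>n. \<Omega> \<alpha> \<beta> n = \<Omega> \<alpha> \<beta> (Suc n))"

definition aperiodic :: "real \<Rightarrow> real \<Rightarrow> bool" where
  "aperiodic \<alpha> \<beta> \<longleftrightarrow> \<not> (\<exists>x\<in>{0..<1}. \<exists>n\<ge>1. (T \<alpha> \<beta> ^^ n) x = x)"

fun G :: "real \<times> real \<Rightarrow> real \<times> real" where
  "G (\<alpha>, \<beta>) = (\<beta> / \<alpha>, (\<beta> - 1) / \<alpha> + of_int \<lfloor>1 / \<alpha>\<rfloor>)"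

(* The Gauss map has domain interior U, while G is total.  The intersection over all n
   forces every iterate to lie in interior U, so values of G off that domain play no role. *)
definition A :: "(real \<times> real) set" where
  "A = (\<Inter>n. (G ^^ n) -` interior U)"

end

(* The Gauss map admits a strictly decreasing density.  The inverse branches of G are
   g_k (u, v) = (1 / (u - v + k), u / (u - v + k)) with Jacobian (u - v + k)^-3, and for
   phi (u, v) = 1 / ((1 + u - v) (1 - v)), which is integrable over U, one finds
     sum_k phi (g_k (u, v)) (u - v + k)^-3 = sum_k 1 / ((k + u - v) (k - v) (k + 1 - v))
                                          < phi (u, v)
   on the interior of U.  Since A is contained in the union of the g_k (A), integrating phi
   over A shows that A is a null set.

   The map induced by T_(alpha, beta) on [1 - alpha, 1) is a rescaled copy of T_G(alpha, beta),
   and inducing reflects finite type and aperiodicity.  Off A some iterate of G has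
   negative second coordinate, where T is eventually a rotation of an interval, which is
   aperiodic unless the point lies on a line with rational coefficients; the points that G
   eventually maps to such lines form a null set. *)
theory Submission
  imports Defs "HOL-Real_Asymp.Real_Asymp"
begin

section \<open>The open triangle and a reformulation of finite type\<close>

lemma interior_U: "interior U = {(\<alpha>, \<beta>). 0 < \<beta> \<and> \<beta> < \<alpha> \<and> \<alpha> < 1}"
proof
  let ?V = "{(\<alpha>::real, \<beta>::real). 0 < \<beta> \<and> \<beta> < \<alpha> \<and> \<alpha> < 1}"
  have "?V = {p. 0 < snd p} \<inter> {p. snd p < fst p} \<inter> {p. fst p < 1}"
    by auto
  moreover have "open \<dots>"
    by (intro open_Int open_Collect_less continuous_intros)
  ultimately have "open ?V"
    by (rule ssubst)
  moreover have "?V \<subseteq> U"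
    by (auto simp: U_def)
  ultimately show "?V \<subseteq> interior U"
    by (intro interior_maximal)
  show "interior U \<subseteq> ?V"
  proof clarify
    fix a b :: real
    assume "(a, b) \<in> interior U"
    then obtain e where e: "e > 0" "ball (a, b) e \<subseteq> U"
      by (auto simp: mem_interior)
    \<comment> \<open>Moving right, up and down inside the ball tests one side of the triangle each:
      \<open>a < 1\<close>, \<open>b < a\<close> and \<open>0 < b\<close>.\<close>
    have "{(a + e/2, b), (a, b + e/2), (a, b - e/2)} \<subseteq> ball (a, b) e"
      using e(1) by (simp add: dist_Pair_Pair dist_real_def)
    then have "(a + e/2, b) \<in> U" "(a, b + e/2) \<in> U" "(a, b - e/2) \<in> U"
      using e(2) by blast+
    then show "0 < b \<and> b < a \<and> a < 1"
      using e(1) by (auto simp: U_def)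
  qed
qed

lemma Omega_eq_funpow: "\<Omega> a b n = (T a b ^^ n) ` {0..<1}"
  by (induction n) (auto simp: image_comp)

lemma funpow_image_fixed:
  assumes "f ` K = K"
  shows "(f ^^ n) ` K = K"
  using assms by (induction n) (simp_all add: image_image[symmetric])

lemma funpow_closed:
  assumes "f ` X \<subseteq> X" "x \<in> X"
  shows "(f ^^ n) x \<in> X"
  using assms by (induction n) auto

text \<open>An invariant \<open>K\<close> inside [0,1) equals its own \<open>m\<close>-th image, so
  it lies in \<open>\<Omega> a b m\<close>; if it also absorbs [0,1) by time \<open>m\<close>, the
  two coincide. In this form finite type can be transferred from an induced map.\<close>

lemma finite_type_iff_absorbing:
  assumes "T a b ` {0..<1} \<subseteq> {0..<1}"
  shows "finite_type a b \<longleftrightarrow>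
    (\<exists>K m. K \<subseteq> {0..<1} \<and> T a b ` K = K \<and> (T a b ^^ m) ` {0..<1} \<subseteq> K)"
proof
  assume "finite_type a b"
  then obtain n where n: "\<Omega> a b n = \<Omega> a b (Suc n)"
    by (auto simp: finite_type_def)
  have "\<Omega> a b n \<subseteq> {0..<1}"
    unfolding Omega_eq_funpow using funpow_closed[OF assms, of _ n] by blast
  then show "\<exists>K m. K \<subseteq> {0..<1} \<and> T a b ` K = K \<and> (T a b ^^ m) ` {0..<1} \<subseteq> K"
    using n unfolding \<Omega>.simps(2) Omega_eq_funpow[symmetric] by (intro exI[of _ "\<Omega> a b n"] exI[of _ n]) simp
next
  assume "\<exists>K m. K \<subseteq> {0..<1} \<and> T a b ` K = K \<and> (T a b ^^ m) ` {0..<1} \<subseteq> K"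
  then obtain K m where K: "K \<subseteq> {0..<1}" "T a b ` K = K" "\<Omega> a b m \<subseteq> K"
    by (auto simp: Omega_eq_funpow)
  have "K \<subseteq> \<Omega> a b m"
    unfolding Omega_eq_funpow using image_mono[OF K(1)] funpow_image_fixed[OF K(2)] by metis
  then have "\<Omega> a b m = K"
    using K(3) by simp
  then show "finite_type a b"
    using K(2) by (auto simp: finite_type_def intro!: exI[of _ m])
qed

section \<open>Transfer from an induced map\<close>

text \<open>Here \<open>g\<close> plays the map induced by \<open>f\<close> on the embedded copy of
  \<open>Y\<close>. The common bound \<open>N\<close> makes absorption times uniform, and return
  times of at least 1 provide \<open>f\<close>-preimages.\<close>

locale induced_system =
  fixes f :: "'a \<Rightarrow> 'a" and X :: "'a set" and g :: "'b \<Rightarrow> 'b" and Y :: "'b set"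
    and e :: "'b \<Rightarrow> 'a" and N :: nat
  assumes f_closed: "f ` X \<subseteq> X" and g_closed: "g ` Y \<subseteq> Y"
    and e_closed: "e ` Y \<subseteq> X" and e_inj: "inj_on e Y"
    and return: "y \<in> Y \<Longrightarrow> \<exists>r\<in>{1..N}. e (g y) = (f ^^ r) (e y)"
    and entry: "x \<in> X \<Longrightarrow> \<exists>k\<le>N. \<exists>y\<in>Y. (f ^^ k) x = e y"
begin

lemma iterated_return:
  assumes "y \<in> Y"
  shows "\<exists>s\<le>N * m. e ((g ^^ m) y) = (f ^^ s) (e y)"
proof (induction m)
  case (Suc m)
  then obtain s where s: "s \<le> N * m" "e ((g ^^ m) y) = (f ^^ s) (e y)" by blast
  obtain r where "r \<le> N" "e (g ((g ^^ m) y)) = (f ^^ r) (e ((g ^^ m) y))"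
    using return[OF funpow_closed[OF g_closed assms, of m]] by auto
  then show ?case
    using s by (intro exI[of _ "r + s"]) (auto simp: funpow_add)
qed simp

text \<open>The lifted set \<open>K'\<close> consists of the forward \<open>f\<close>-orbits of the
  copy of \<open>K\<close>. Since \<open>g\<close> maps \<open>K\<close> onto itself, every point of
  that copy is reached from the copy after at least one step of \<open>f\<close>, so
  \<open>f\<close> maps \<open>K'\<close> onto itself.\<close>

lemma absorbing_set_lift:
  assumes K: "K \<subseteq> Y" "g ` K = K" "(g ^^ m) ` Y \<subseteq> K"
  shows "\<exists>K' m'. K' \<subseteq> X \<and> f ` K' = K' \<and> (f ^^ m') ` X \<subseteq> K'"
proof -
  define K' where "K' = (\<Union>j. (f ^^ j) ` e ` K)"
  have mem: "(f ^^ j) (e y) \<in> K'" if "y \<in> K" for j y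
    using that by (auto simp: K'_def)
  have "f ` K' \<subseteq> K'"
  proof
    fix x assume "x \<in> f ` K'"
    then obtain j y where "y \<in> K" "x = f ((f ^^ j) (e y))"
      by (auto simp: K'_def)
    then show "x \<in> K'"
      using mem[of y "Suc j"] by simp
  qed
  moreover have "K' \<subseteq> f ` K'"
  proof
    fix x assume "x \<in> K'"
    then obtain j y where jy: "y \<in> K" "x = (f ^^ j) (e y)"
      by (auto simp: K'_def)
    obtain z where z: "z \<in> K" "y = g z"
      using K(2) jy(1) by auto
    obtain r where r: "r \<ge> 1" "e (g z) = (f ^^ r) (e z)"
      using return[of z] z(1) K(1) atLeastAtMost_iff by blast
    have "x = (f ^^ (j + r)) (e z)"
      using jy z r by (simp add: funpow_add)
    also have "j + r = Suc (j + r - 1)"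
      using r by simp
    finally have "x = f ((f ^^ (j + r - 1)) (e z))"
      by simp
    then show "x \<in> f ` K'"
      using mem[OF z(1)] by blast
  qed
  moreover have "K' \<subseteq> X"
  proof
    fix x assume "x \<in> K'"
    then obtain j y where "y \<in> K" "x = (f ^^ j) (e y)"
      by (auto simp: K'_def)
    then show "x \<in> X"
      using funpow_closed[OF f_closed, of "e y" j] e_closed K(1) by blast
  qed
  moreover have "(f ^^ (N * m + N)) x \<in> K'" if x: "x \<in> X" for x
  proof -
    obtain k y where k: "k \<le> N" "y \<in> Y" "(f ^^ k) x = e y"
      using entry[OF x] by blast
    obtain s where s: "s \<le> N * m" "e ((g ^^ m) y) = (f ^^ s) (e y)"
      using iterated_return[OF k(2)] by blast
    \<comment> \<open>Entering the copy of \<open>Y\<close> costs at most \<open>N\<close> steps and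
      \<open>m\<close> iterates of \<open>g\<close> at most \<open>N * m\<close>; the steps left
      over stay in \<open>K'\<close>.\<close>
    have "N * m + N = (N * m + N - (s + k)) + (s + k)"
      using k s by simp
    then have "(f ^^ (N * m + N)) x = (f ^^ (N * m + N - (s + k))) (e ((g ^^ m) y))"
      using k s by (metis comp_apply funpow_add)
    then show ?thesis
      using mem K(3) k(2) by auto
  qed
  ultimately show ?thesis
    by (intro exI[of _ K'] exI[of _ "N * m + N"]) auto
qed

text \<open>The map \<open>g\<close> need not be the first return map: a periodic \<open>f\<close>-orbit is finite, so
  the \<open>g\<close>-orbit inside it repeats.\<close>

lemma periodic_point_descent:
  assumes x: "x \<in> X" and n: "n \<ge> 1" "(f ^^ n) x = x"
  shows "\<exists>z\<in>Y. \<exists>m\<ge>1. (g ^^ m) z = z"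
proof -
  obtain k y where k: "y \<in> Y" "(f ^^ k) x = e y"
    using entry[OF x] by blast
  have per: "(f ^^ n) (e y) = e y"
    by (metis add.commute comp_apply funpow_add k(2) n(2))
  have "e ((g ^^ i) y) \<in> (\<lambda>j. (f ^^ j) (e y)) ` {..<n}" for i
  proof -
    obtain s where s: "e ((g ^^ i) y) = (f ^^ s) (e y)"
      using iterated_return[OF k(1)] by blast
    also have "\<dots> = (f ^^ (s mod n)) (e y)"
      using per by (simp add: funpow_mod_eq)
    finally show ?thesis using n(1) by auto
  qed
  then have "range (\<lambda>i. e ((g ^^ i) y)) \<subseteq> (\<lambda>j. (f ^^ j) (e y)) ` {..<n}"
    by blast
  then have "finite (range (\<lambda>i. e ((g ^^ i) y)))"
    by (rule finite_subset) simp
  then have "\<not> inj (\<lambda>i. e ((g ^^ i) y))"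
    using finite_imageD infinite_UNIV_nat by blast
  then obtain i j where ij: "i < j" "e ((g ^^ i) y) = e ((g ^^ j) y)"
    using linorder_injI[of "\<lambda>i. e ((g ^^ i) y)"] by blast
  then have "(g ^^ i) y = (g ^^ j) y"
    using inj_onD[OF e_inj] funpow_closed[OF g_closed k(1)] by blast
  then have "(g ^^ (j - i)) ((g ^^ i) y) = (g ^^ i) y"
    using ij(1) by (metis comp_apply funpow_add le_add_diff_inverse2 less_imp_le_nat)
  moreover have "j - i \<ge> 1"
    using ij(1) by simp
  ultimately show ?thesis
    using funpow_closed[OF g_closed k(1), of i] by blast
qed

end

section \<open>Renormalization of \<open>T\<close> by the Gauss map\<close>

lemma T_closed:
  assumes "0 < a" "a < 1" "b < 1" "a - 1 \<le> b" "b \<le> a"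
  shows "T a b ` {0..<1} \<subseteq> {0..<1}"
  using assms by (auto simp: T_def)

text \<open>If the endpoint is below 1, all earlier points are below \<open>1 - a\<close>, so only
  the first branch acts.\<close>

lemma T_climb:
  assumes "0 < a" "0 \<le> x" "x + real k * a < 1"
  shows "(T a b ^^ k) x = x + real k * a"
  using assms
proof (induction k)
  case (Suc k)
  then have "x + real k * a < 1 - a"
    by (simp add: algebra_simps)
  with Suc show ?case by (auto simp: T_def algebra_simps)
qed simp

lemma T_reaches_top:
  fixes a b x :: real
  assumes "0 < a" "0 \<le> x" "x < 1"
  obtains k where "k \<le> nat \<lceil>1 / a\<rceil>" "1 - a \<le> (T a b ^^ k) x" "(T a b ^^ k) x < 1"
proof -
  \<comment> \<open>The largest number of steps of length \<open>a\<close> that stays strictly below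
    1; ceiling minus one also treats integral \<open>(1 - x) / a\<close> correctly.\<close>
  define k where "k = nat (\<lceil>(1 - x) / a\<rceil> - 1)"
  have pos: "\<lceil>(1 - x) / a\<rceil> \<ge> 1"
    using assms by simp
  then have k: "real k = of_int \<lceil>(1 - x) / a\<rceil> - 1"
    by (simp add: k_def)
  have "real k < (1 - x) / a" "(1 - x) / a \<le> real k + 1"
    unfolding k by linarith+
  then have kx: "x + real k * a < 1" "1 - a \<le> x + real k * a"
    using assms by (auto simp: field_simps)
  have "\<lceil>(1 - x) / a\<rceil> \<le> \<lceil>1 / a\<rceil>"
    using assms by (intro ceiling_mono divide_right_mono) auto
  then have "k \<le> nat \<lceil>1 / a\<rceil>"
    by (simp add: k_def)
  with kx T_climb[OF assms(1,2) kx(1), of b] show thesis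
    by (intro that[of k]) auto
qed

text \<open>The affine map carries [0,1) onto [1 - a, 1), on which \<open>T a b\<close> is induced.
  The bounds on \<open>b'\<close> hold because \<open>a' - b'\<close> is the fractional part of
  \<open>1 / a\<close>. With \<open>N\<close> the floor of \<open>1 / a\<close>, the return times
  are 1, \<open>N\<close> and \<open>N + 1\<close>.\<close>

lemma renormalization:
  fixes a b :: real
  assumes ab: "0 < b" "b < a" "a < 1" and G: "G (a, b) = (a', b')"
  shows "0 < a'" "a' < 1" "a' - 1 < b'" "b' \<le> a'"
    and "induced_system (T a b) {0..<1} (T a' b') {0..<1} (\<lambda>y. 1 - a + a * y) (nat \<lceil>1 / a\<rceil> + 1)"
proof -
  define N where "N = nat \<lfloor>1 / a\<rfloor>"
  have "\<lfloor>1 / a\<rfloor> \<ge> 1"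
    using ab by simp
  then have N: "real N = of_int \<lfloor>1 / a\<rfloor>" "N \<ge> 1"
    unfolding N_def by linarith+
  have N_bounds: "real N \<le> 1 / a" "1 / a < real N + 1"
    unfolding N by linarith+
  have a': "a' = b / a" and b': "b' = (b - 1) / a + real N"
    using G by (auto simp: N)
  show bounds: "0 < a'" "a' < 1" "a' - 1 < b'" "b' \<le> a'"
    using ab N_bounds by (auto simp: a' b' diff_divide_distrib)
  let ?e = "\<lambda>y. 1 - a + a * y"
  have N_le: "N \<le> nat \<lceil>1 / a\<rceil>"
    unfolding N_def by (intro nat_mono floor_le_ceiling)
  show "induced_system (T a b) {0..<1} (T a' b') {0..<1} ?e (nat \<lceil>1 / a\<rceil> + 1)"
  proof
    show "T a b ` {0..<1} \<subseteq> {0..<1}"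
      using ab by (intro T_closed) auto
    show "T a' b' ` {0..<1} \<subseteq> {0..<1}"
      using bounds by (intro T_closed) auto
    have "a * y < a" if "y < 1" for y
      using that ab by simp
    then show "?e ` {0..<1} \<subseteq> {0..<1}"
      using ab by (force intro!: add_nonneg_nonneg)
    show "inj_on ?e {0..<1}"
      using ab by (auto simp: inj_on_def)
    show "\<exists>k\<le>nat \<lceil>1 / a\<rceil> + 1. \<exists>y\<in>{0..<1}. (T a b ^^ k) x = ?e y" if x: "x \<in> {0..<1}" for x
    proof -
      obtain k where k: "k \<le> nat \<lceil>1 / a\<rceil>" "1 - a \<le> (T a b ^^ k) x" "(T a b ^^ k) x < 1"
        using T_reaches_top[of a x b] x ab by auto
      define y where "y = ((T a b ^^ k) x - (1 - a)) / a"
      have "y \<in> {0..<1}" "(T a b ^^ k) x = ?e y"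
        using k ab by (auto simp: y_def field_simps)
      then show ?thesis using k(1) by (intro exI[of _ k]) auto
    qed
    show "\<exists>r\<in>{1..nat \<lceil>1 / a\<rceil> + 1}. ?e (T a' b' y) = (T a b ^^ r) (?e y)" if y: "y \<in> {0..<1}" for y
    proof (cases "y < 1 - a'")
      \<comment> \<open>The middle branch of \<open>T a b\<close> stays in [1 - a, 1), so one step
        is enough.\<close>
      case True
      then have "a * y < a - b"
        using ab by (simp add: a' field_simps)
      then have "T a b (?e y) = ?e y + b"
        using ab y by (simp add: T_def not_less)
      moreover have "?e (T a' b' y) = ?e y + b"
        using True ab by (simp add: T_def a' field_simps)
      ultimately show ?thesis
        by (intro bexI[of _ 1]) auto
    next
      case False
      \<comment> \<open>The third branch drops to \<open>z\<close>. Climbing back takes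
        \<open>N\<close> steps of length \<open>a\<close>, or \<open>N - 1\<close> if the last of
        them would reach 1 or more.\<close>
      define z where "z = a * y - a + b"
      have "a * y \<ge> a - b"
        using False ab by (simp add: a' field_simps)
      then have z: "T a b (?e y) = z" "z \<ge> 0"
        using ab y by (auto simp: T_def z_def)
      have climb: "(T a b ^^ Suc k) (?e y) = z + real k * a" if "z + real k * a < 1" for k
        using T_climb[OF _ z(2) that, of b] ab z(1) by (simp add: funpow_swap1)
      have e1: "?e (y + b') = z + real N * a"
        using ab by (simp add: z_def b' field_simps)
      have lt: "?e t < 1 \<longleftrightarrow> t < 1" for t
        using ab by simp
      show ?thesis
      proof (cases "y < 1 - b'")
        case True
        have "?e (y + b') < 1"
          using True by (subst lt) simp
        then have "(T a b ^^ Suc N) (?e y) = ?e (T a' b' y)"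
          using climb[of N] e1 True False by (simp add: T_def)
        then show ?thesis
          using N_le by (intro bexI[of _ "Suc N"]) auto
      next
        case f2: False
        have e2: "?e (y + b' - 1) = z + real (N - 1) * a"
          using e1 N(2) by (simp add: of_nat_diff algebra_simps)
        have "?e (y + b' - 1) < 1"
          using y bounds by (subst lt) auto
        then have "(T a b ^^ Suc (N - 1)) (?e y) = ?e (T a' b' y)"
          using climb[of "N - 1"] e2 f2 False by (simp add: T_def)
        then show ?thesis
          using N_le N(2) by (intro bexI[of _ "Suc (N - 1)"]) auto
      qed
    qed
  qed
qed

lemma finite_type_aperiodic_step:
  assumes "(a, b) \<in> interior U" "G (a, b) = (a', b')" "finite_type a' b' \<and> aperiodic a' b'"
  shows "finite_type a b \<and> aperiodic a b"
proof -
  have ab: "0 < b" "b < a" "a < 1"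
    using assms(1) by (auto simp: interior_U)
  interpret induced_system "T a b" "{0..<1}" "T a' b'" "{0..<1}" "\<lambda>y. 1 - a + a * y" "nat \<lceil>1 / a\<rceil> + 1"
    by (rule renormalization(5)[OF ab assms(2)])
  obtain K m where "K \<subseteq> {0..<1}" "T a' b' ` K = K" "(T a' b' ^^ m) ` {0..<1} \<subseteq> K"
    using assms(3) finite_type_iff_absorbing[OF g_closed] by auto
  then have "finite_type a b"
    unfolding finite_type_iff_absorbing[OF f_closed] by (rule absorbing_set_lift)
  moreover have "aperiodic a b"
    unfolding aperiodic_def
  proof
    assume "\<exists>x\<in>{0..<1}. \<exists>n\<ge>1. (T a b ^^ n) x = x"
    then obtain x n where "x \<in> {0..<1}" "n \<ge> 1" "(T a b ^^ n) x = x"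
      by blast
    from periodic_point_descent[OF this] assms(3) show False
      unfolding aperiodic_def by blast
  qed
  ultimately show ?thesis by simp
qed

section \<open>Negative second coordinate and points outside \<open>A\<close>\<close>

text \<open>For negative \<open>b\<close> the third branch of \<open>T a b\<close> is empty, and \<open>T a b\<close> is, after
  finitely many steps, the rotation by \<open>a\<close> modulo \<open>a - b\<close> on \<open>[1 - (a - b), 1)\<close>.\<close>

lemma finite_type_negative:
  assumes ab: "0 < a" "a < 1" "a - 1 < b" "b < 0"
  shows "finite_type a b"
proof -
  have closed: "T a b ` {0..<1} \<subseteq> {0..<1}"
    using ab by (intro T_closed) auto
  define J where "J = {1 - (a - b)..<1}"
  have sub: "T a b ` J \<subseteq> J"
    using ab by (auto simp: J_def T_def)
  moreover have "J \<subseteq> T a b ` J"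
  proof
    fix y assume y: "y \<in> J"
    \<comment> \<open>The parts of \<open>J\<close> below and above \<open>1 - a\<close> are
      translated onto [1 + b, 1) and [1 - (a - b), 1 + b), hence the split at
      \<open>1 + b\<close>.\<close>
    show "y \<in> T a b ` J"
    proof (cases "y < 1 + b")
      case True
      then show ?thesis
        using ab y by (intro image_eqI[of _ _ "y - b"]) (auto simp: J_def T_def)
    next
      case False
      then show ?thesis
        using ab y by (intro image_eqI[of _ _ "y - a"]) (auto simp: J_def T_def)
    qed
  qed
  moreover have "(T a b ^^ nat \<lceil>1 / a\<rceil>) x \<in> J" if x: "x \<in> {0..<1}" for x
  proof -
    obtain k where k: "k \<le> nat \<lceil>1 / a\<rceil>" "1 - a \<le> (T a b ^^ k) x" "(T a b ^^ k) x < 1"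
      using T_reaches_top[of a x b] x ab by auto
    then have "(T a b ^^ k) x \<in> J"
      using ab by (auto simp: J_def)
    then have "(T a b ^^ (nat \<lceil>1 / a\<rceil> - k)) ((T a b ^^ k) x) \<in> J"
      by (rule funpow_closed[OF sub])
    then show ?thesis
      using k(1) by (metis comp_apply funpow_add le_add_diff_inverse2)
  qed
  moreover have "J \<subseteq> {0..<1}"
    using ab by (auto simp: J_def)
  ultimately show ?thesis
    unfolding finite_type_iff_absorbing[OF closed]
    by (intro exI[of _ J] exI[of _ "nat \<lceil>1 / a\<rceil>"]) blast
qed

text \<open>Besides the relations forced by periodic points, this family contains the lines through
  the sides of \<open>U\<close> and the line \<open>a - b = 1\<close>, so one null set handles all
  exceptional parameters.\<close>

definition rational_lines :: "(real \<times> real) set" where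
  "rational_lines = {(a, b). \<exists>i j k :: int. (i, j) \<noteq> (0, 0) \<and> of_int i * a + of_int j * b = of_int k}"

lemma rational_linesI:
  assumes "of_int i * a + of_int j * b = of_int k" "(i, j) \<noteq> (0, 0)"
  shows "(a, b) \<in> rational_lines"
  using assms unfolding rational_lines_def by blast

text \<open>Each step adds \<open>a\<close> or \<open>b\<close>, so a return to the starting point
  is an integer relation between them with nonnegative coefficients summing to the period.\<close>

lemma aperiodic_negative:
  assumes ab: "0 < a" "a < 1" "a - 1 < b" "b < 0" and irr: "(a, b) \<notin> rational_lines"
  shows "aperiodic a b"
proof -
  have closed: "T a b ` {0..<1} \<subseteq> {0..<1}"
    using ab by (intro T_closed) auto
  have displacement: "\<exists>i j. i + j = n \<and> (T a b ^^ n) x = x + real i * a + real j * b"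
    if x: "x \<in> {0..<1}" for x n
  proof (induction n)
    case (Suc n)
    then obtain i j where ij: "i + j = n" "(T a b ^^ n) x = x + real i * a + real j * b"
      by blast
    have "(T a b ^^ n) x < 1"
      using funpow_closed[OF closed x, of n] by simp
    then have "T a b ((T a b ^^ n) x) = (T a b ^^ n) x + a \<or>
        T a b ((T a b ^^ n) x) = (T a b ^^ n) x + b"
      using ab by (auto simp: T_def)
    then show ?case
    proof
      assume "T a b ((T a b ^^ n) x) = (T a b ^^ n) x + a"
      then show ?thesis
        using ij by (intro exI[of _ "Suc i"] exI[of _ j]) (auto simp: algebra_simps)
    next
      assume "T a b ((T a b ^^ n) x) = (T a b ^^ n) x + b"
      then show ?thesis
        using ij by (intro exI[of _ i] exI[of _ "Suc j"]) (auto simp: algebra_simps)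
    qed
  qed simp
  have False if x: "x \<in> {0..<1}" and n: "n \<ge> 1" "(T a b ^^ n) x = x" for x n
  proof -
    obtain i j where ij: "i + j = n" "(T a b ^^ n) x = x + real i * a + real j * b"
      using displacement[OF x] by blast
    then have "of_int (int i) * a + of_int (int j) * b = of_int 0" "(int i, int j) \<noteq> (0, 0)"
      using n by auto
    then show False
      using irr rational_linesI by blast
  qed
  then show ?thesis
    unfolding aperiodic_def by blast
qed

text \<open>At the first exit time from \<open>interior U\<close> the second coordinate is negative,
  which settles that parameter; the properties are then pulled back one application of
  \<open>G\<close> at a time.\<close>

lemma finite_type_aperiodic_outside_A:
  assumes "p \<in> U" "p \<notin> A"
    and irr: "\<And>n. \<forall>i<n. (G ^^ i) p \<in> interior U \<Longrightarrow> (G ^^ n) p \<notin> rational_lines"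
  shows "case p of (a, b) \<Rightarrow> finite_type a b \<and> aperiodic a b"
proof -
  have line: "b \<noteq> 0 \<and> a \<noteq> b \<and> a \<noteq> 1" if "(a, b) \<notin> rational_lines" for a b
    using rational_linesI[of 0 a 1 b 0] rational_linesI[of 1 a "-1" b 0] rational_linesI[of 1 a 0 b 1] that
    by auto
  have pU: "p \<in> interior U"
    using line[of "fst p" "snd p"] irr[of 0] assms(1) unfolding interior_U by (cases p) (auto simp: U_def)
  define n where "n = (LEAST n. (G ^^ n) p \<notin> interior U)"
  have "\<exists>n. (G ^^ n) p \<notin> interior U"
    using assms(2) by (auto simp: A_def)
  then have n: "(G ^^ n) p \<notin> interior U"
    unfolding n_def by (rule LeastI_ex)
  have before: "(G ^^ i) p \<in> interior U" if "i < n" for i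
    using that not_less_Least unfolding n_def by blast
  have "n \<noteq> 0"
    using n pU by (metis funpow_0)
  then obtain m where m: "n = Suc m"
    using not0_implies_Suc by blast
  have good: "case (G ^^ (n - i)) p of (a, b) \<Rightarrow> finite_type a b \<and> aperiodic a b" if "i \<le> n" for i
    using that
  proof (induction i)
    case 0
    obtain a b where q: "(G ^^ m) p = (a, b)" by fastforce
    obtain a' b' where G: "G (a, b) = (a', b')" by fastforce
    have Gn: "(G ^^ n) p = (a', b')"
      using q G by (simp add: m)
    have ab: "0 < b" "b < a" "a < 1"
      using before[of m] q by (auto simp: m interior_U)
    note r = renormalization(1-4)[OF ab G]
    have notin: "(a', b') \<notin> rational_lines"
      using irr[of n] before Gn by simp
    \<comment> \<open>The bounds on \<open>(a', b')\<close> allow an exit only through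
      \<open>b' \<le> 0\<close> or \<open>b' = a'\<close>; avoiding the lines excludes both
      equalities.\<close>
    then have "b' < 0"
      using line[OF notin] n r by (auto simp: Gn interior_U)
    then show ?case
      using finite_type_negative[of a' b'] aperiodic_negative[of a' b'] r notin Gn by simp
  next
    case (Suc i)
    obtain a b where q: "(G ^^ (n - Suc i)) p = (a, b)" by fastforce
    obtain a' b' where G: "G (a, b) = (a', b')" by fastforce
    have "n - i = Suc (n - Suc i)"
      using Suc by simp
    then have "(G ^^ (n - i)) p = (a', b')"
      using q G by simp
    moreover have "(a, b) \<in> interior U"
      using before[of "n - Suc i"] q Suc by simp
    ultimately show ?case
      using finite_type_aperiodic_step[OF _ G] Suc q by simp
  qed
  show ?thesis
    using good[of n] by simp
qed

section \<open>Inverse branches and change of variables\<close>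

definition gauss_branch :: "nat \<Rightarrow> real \<times> real \<Rightarrow> real \<times> real" where
  "gauss_branch k = (\<lambda>(u, v). (1 / (u - v + real k), u / (u - v + real k)))"

lemma measurable_gauss_branch [measurable]: "gauss_branch k \<in> borel_measurable borel"
  unfolding gauss_branch_def borel_prod[symmetric] by measurable

lemma measurable_G [measurable]: "G \<in> borel_measurable borel"
proof -
  have "G = (\<lambda>p. (snd p / fst p, (snd p - 1) / fst p + of_int \<lfloor>1 / fst p\<rfloor>))"
    by auto
  also have "\<dots> \<in> borel_measurable borel"
    unfolding borel_prod[symmetric] by measurable
  finally show ?thesis .
qed

lemma measurable_funpow_G [measurable]: "(G ^^ n) \<in> borel_measurable borel"
  by (induction n) (auto intro: measurable_comp[OF _ measurable_G])

lemma sets_A [measurable]: "A \<in> sets borel"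
proof -
  have "(G ^^ n) -` interior U \<in> sets borel" for n
    using measurable_sets[OF measurable_funpow_G, of "interior U" n] by simp
  then show ?thesis
    unfolding A_def by blast
qed

lemma nn_integral_lborel_prod:
  fixes f :: "real \<times> real \<Rightarrow> ennreal"
  assumes "f \<in> borel_measurable borel"
  shows "(\<integral>\<^sup>+ p. f p \<partial>lborel) = (\<integral>\<^sup>+ x. \<integral>\<^sup>+ y. f (x, y) \<partial>lborel \<partial>lborel)"
  using assms by (subst lborel_prod[symmetric], subst lborel.nn_integral_fst) (simp_all add: lborel_prod)

text \<open>Two one-dimensional substitutions separated by Fubini: \<open>b = a * u\<close> for
  fixed \<open>a\<close>, then \<open>a = 1 / (u - v + k)\<close> for fixed \<open>u\<close>, where
  \<open>k = Suc i\<close>.\<close>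

lemma nn_integral_le_sum_gauss_branches:
  fixes f :: "real \<times> real \<Rightarrow> ennreal"
  assumes [measurable]: "f \<in> borel_measurable borel"
    and supp: "\<And>a b. f (a, b) \<noteq> 0 \<Longrightarrow> 0 < a \<and> a < 1"
  shows "(\<integral>\<^sup>+ p. f p \<partial>lborel) \<le>
    (\<Sum>i. \<integral>\<^sup>+ p. f (gauss_branch (Suc i) p) * ennreal (1 / (fst p - snd p + Suc i) ^ 3) *
      indicator {p. fst p - 1 \<le> snd p \<and> snd p \<le> fst p} p \<partial>lborel)"
proof -
  have [measurable]: "f \<in> borel_measurable (borel \<Otimes>\<^sub>M borel)"
    by (simp add: borel_prod)
  have [measurable]: "(\<lambda>p. f (gauss_branch k p)) \<in> borel_measurable (borel \<Otimes>\<^sub>M borel)" for k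
    unfolding borel_prod by measurable
  have inner: "(\<integral>\<^sup>+ b. f (a, b) \<partial>lborel) = (\<integral>\<^sup>+ u. ennreal a * f (a, a * u) \<partial>lborel)" for a
  proof (cases "0 < a")
    case True
    then show ?thesis
      by (subst nn_integral_real_affine[where c = a and t = 0]) (simp_all add: nn_integral_cmult)
  next
    case False
    then have "f (a, b) = 0" for b
      using supp by blast
    then show ?thesis by simp
  qed
  have outer: "(\<integral>\<^sup>+ a. ennreal a * f (a, a * u) \<partial>lborel) \<le>
      (\<Sum>i. \<integral>\<^sup>+ v. f (gauss_branch (Suc i) (u, v)) * ennreal (1 / (u - v + Suc i) ^ 3) *
        indicator {u - 1..u} v \<partial>lborel)" for u
  proof -
    define h where "h a = ennreal a * f (a, a * u)" for a
    have [measurable]: "h \<in> borel_measurable borel"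
      unfolding h_def by measurable
    \<comment> \<open>The closed intervals [1/(k+1), 1/k] share endpoints, so the sum may count a
      point twice; the inequality is enough.\<close>
    have cover: "h a \<le> (\<Sum>i. h a * indicator {1 / (1 + real (Suc i))..1 / real (Suc i)} a)" for a
    proof (cases "0 < a \<and> a < 1")
      case True
      define i where "i = nat \<lfloor>1 / a\<rfloor> - 1"
      have "\<lfloor>1 / a\<rfloor> \<ge> 1"
        using True by simp
      then have "real (Suc i) = of_int \<lfloor>1 / a\<rfloor>"
        unfolding i_def by linarith
      then have "real (Suc i) \<le> 1 / a" "1 / a \<le> 1 + real (Suc i)"
        by linarith+
      then have "a \<in> {1 / (1 + real (Suc i))..1 / real (Suc i)}"
        using True by (auto simp: field_simps)
      then have "h a = (\<Sum>j\<in>{i}. h a * indicator {1 / (1 + real (Suc j))..1 / real (Suc j)} a)"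
        by simp
      also have "\<dots> \<le> (\<Sum>i. h a * indicator {1 / (1 + real (Suc i))..1 / real (Suc i)} a)"
        by (intro sum_le_suminf) auto
      finally show ?thesis .
    next
      case False
      then have "f (a, a * u) = 0"
        using supp by blast
      then show ?thesis by (simp add: h_def)
    qed
    have branch: "(\<integral>\<^sup>+ a. h a * indicator {1 / (1 + real (Suc i))..1 / real (Suc i)} a \<partial>lborel) =
      (\<integral>\<^sup>+ v. f (gauss_branch (Suc i) (u, v)) * ennreal (1 / (u - v + Suc i) ^ 3) *
        indicator {u - 1..u} v \<partial>lborel)" for i
    proof -
      have pos: "u - v + real (Suc i) > 0" if "v \<in> {u - 1..u}" for v
        using that by auto
      have "(\<integral>\<^sup>+ a. h a * indicator {1 / (u - (u - 1) + real (Suc i))..1 / (u - u + real (Suc i))} a \<partial>lborel) =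
        (\<integral>\<^sup>+ v. h (1 / (u - v + real (Suc i))) * ennreal (1 / (u - v + real (Suc i)) ^ 2) *
          indicator {u - 1..u} v \<partial>lborel)"
      proof (rule nn_integral_substitution_aux)
        fix v assume "v \<in> {u - 1..u}"
        then show "((\<lambda>v. 1 / (u - v + real (Suc i))) has_real_derivative 1 / (u - v + real (Suc i)) ^ 2) (at v)"
          using pos[of v] by (auto intro!: derivative_eq_intros simp: power2_eq_square)
      next
        show "continuous_on {u - 1..u} (\<lambda>v. 1 / (u - v + real (Suc i)) ^ 2)"
          by (intro continuous_intros) (auto dest!: pos simp del: of_nat_Suc)
      qed auto
      also have "\<dots> = (\<integral>\<^sup>+ v. f (gauss_branch (Suc i) (u, v)) * ennreal (1 / (u - v + Suc i) ^ 3) *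
        indicator {u - 1..u} v \<partial>lborel)"
      proof (intro nn_integral_cong)
        fix v
        show "h (1 / (u - v + real (Suc i))) * ennreal (1 / (u - v + real (Suc i)) ^ 2) * indicator {u - 1..u} v =
          f (gauss_branch (Suc i) (u, v)) * ennreal (1 / (u - v + Suc i) ^ 3) * indicator {u - 1..u} v"
        proof (cases "v \<in> {u - 1..u}")
          case True
          define d where "d = u - v + real (Suc i)"
          have "d > 0"
            using pos[OF True] by (simp add: d_def)
          \<comment> \<open>One factor \<open>1 / d\<close> comes from the substitution in
            \<open>b\<close>, two from the derivative in \<open>v\<close>.\<close>
          then have "ennreal (1 / d ^ 3) = ennreal (1 / d) * ennreal (1 / d ^ 2)"
            by (simp add: ennreal_mult[symmetric] power2_eq_square power3_eq_cube)
          then show ?thesis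
            by (simp add: h_def gauss_branch_def d_def[symmetric] mult_ac del: of_nat_Suc)
        qed simp
      qed
      finally show ?thesis by simp
    qed
    have "(\<integral>\<^sup>+ a. h a \<partial>lborel) \<le>
        (\<integral>\<^sup>+ a. (\<Sum>i. h a * indicator {1 / (1 + real (Suc i))..1 / real (Suc i)} a) \<partial>lborel)"
      by (intro nn_integral_mono cover)
    also have "\<dots> = (\<Sum>i. \<integral>\<^sup>+ a. h a * indicator {1 / (1 + real (Suc i))..1 / real (Suc i)} a \<partial>lborel)"
      by (intro nn_integral_suminf) measurable
    finally show ?thesis
      unfolding branch unfolding h_def .
  qed
  have "(\<integral>\<^sup>+ p. f p \<partial>lborel) = (\<integral>\<^sup>+ a. \<integral>\<^sup>+ u. ennreal a * f (a, a * u) \<partial>lborel \<partial>lborel)"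
    by (simp add: nn_integral_lborel_prod inner)
  also have "\<dots> = (\<integral>\<^sup>+ u. \<integral>\<^sup>+ a. ennreal a * f (a, a * u) \<partial>lborel \<partial>lborel)"
    by (rule lborel_pair.Fubini'[symmetric]) measurable
  also have "\<dots> \<le> (\<integral>\<^sup>+ u. (\<Sum>i. \<integral>\<^sup>+ v. f (gauss_branch (Suc i) (u, v)) * ennreal (1 / (u - v + Suc i) ^ 3) *
        indicator {u - 1..u} v \<partial>lborel) \<partial>lborel)"
    by (intro nn_integral_mono outer)
  also have "\<dots> = (\<integral>\<^sup>+ u. (\<Sum>i. \<integral>\<^sup>+ v. f (gauss_branch (Suc i) (u, v)) * ennreal (1 / (u - v + Suc i) ^ 3) *
        indicator {p. fst p - 1 \<le> snd p \<and> snd p \<le> fst p} (u, v) \<partial>lborel) \<partial>lborel)"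
    by (intro nn_integral_cong suminf_cong) (simp add: indicator_def)
  also have "\<dots> = (\<Sum>i. \<integral>\<^sup>+ u. \<integral>\<^sup>+ v. f (gauss_branch (Suc i) (u, v)) * ennreal (1 / (u - v + Suc i) ^ 3) *
        indicator {p. fst p - 1 \<le> snd p \<and> snd p \<le> fst p} (u, v) \<partial>lborel \<partial>lborel)"
    by (intro nn_integral_suminf) (simp add: gauss_branch_def)
  also have "\<dots> = (\<Sum>i. \<integral>\<^sup>+ p. f (gauss_branch (Suc i) p) * ennreal (1 / (fst p - snd p + Suc i) ^ 3) *
      indicator {p. fst p - 1 \<le> snd p \<and> snd p \<le> fst p} p \<partial>lborel)"
    by (subst nn_integral_lborel_prod) (simp_all add: borel_prod[symmetric])
  finally show ?thesis .
qed

text \<open>Since \<open>u - v\<close> lies in [0,1), the floor in \<open>G\<close> recovers exactly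
  \<open>k\<close>.\<close>

lemma G_gauss_branch:
  assumes "u - 1 < v" "v \<le> u" "k \<ge> 1"
  shows "G (gauss_branch k (u, v)) = (u, v)"
proof -
  define d where "d = u - v + real k"
  have d: "d > 0"
    using assms by (simp add: d_def)
  have "\<lfloor>d\<rfloor> = int k"
    using assms by (intro floor_unique) (auto simp: d_def)
  then have "G (gauss_branch k (u, v)) = (u, (u / d - 1) * d + real k)"
    using d by (simp add: gauss_branch_def d_def[symmetric])
  also have "(u / d - 1) * d = v - real k"
    using d by (simp add: left_diff_distrib) (simp add: d_def)
  finally show ?thesis by simp
qed

text \<open>On the edge \<open>u - v = 1\<close> of the strip the floor jumps to
  \<open>k + 1\<close>. The resulting image is on the diagonal, hence outside
  \<open>interior U\<close>.\<close>

lemma G_gauss_branch_edge: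
  assumes "v = u - 1"
  shows "G (gauss_branch k (u, v)) = (u, u)"
proof -
  have "\<lfloor>1 + real k\<rfloor> = int k + 1"
    by linarith
  moreover have "u - v + real k = 1 + real k"
    using assms by simp
  ultimately have "G (gauss_branch k (u, v)) = (u, (u / (1 + real k) - 1) * (1 + real k) + (real k + 1))"
    by (simp add: gauss_branch_def)
  then show ?thesis
    by (simp add: left_diff_distrib)
qed

section \<open>Null sets and their preimages under \<open>G\<close>\<close>

lemma null_sets_rational_lines: "rational_lines \<in> null_sets lborel"
proof -
  define L :: "int \<times> int \<times> int \<Rightarrow> (real \<times> real) set"
    where "L = (\<lambda>(i, j, k). {p. (of_int i, of_int j) \<bullet> p = of_int k})"
  have "L (i, j, k) \<in> null_sets lborel" if "(i, j) \<noteq> (0, 0)" for i j k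
  proof -
    have "negligible (L (i, j, k))"
      unfolding L_def prod.case using that by (intro negligible_hyperplane) (auto simp: zero_prod_def)
    moreover have "closed (L (i, j, k))"
      unfolding L_def prod.case by (rule closed_hyperplane)
    ultimately show ?thesis
      by (auto simp: negligible_iff_null_sets null_sets_completion_iff)
  qed
  then have "(\<Union>t\<in>{(i, j, k). (i, j) \<noteq> (0, 0)}. L t) \<in> null_sets lborel"
    by (intro null_sets_UN') auto
  moreover have "rational_lines = (\<Union>t\<in>{(i, j, k). (i, j) \<noteq> (0, 0)}. L t)"
    by (auto simp: rational_lines_def L_def; blast)
  ultimately show ?thesis by simp
qed

text \<open>The change of variables is applied to the indicator of the preimage. As \<open>G\<close>
  undoes each branch off the line \<open>u - v = 1\<close>, every integrand vanishes outside
  \<open>S\<close> and a null set.\<close>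

lemma null_sets_vimage_G:
  assumes S: "S \<in> null_sets lborel"
  shows "interior U \<inter> G -` S \<in> null_sets lborel"
proof -
  define E where "E = interior U \<inter> G -` S"
  have "G -` S \<in> sets borel"
    using measurable_sets[OF measurable_G, of S] S by auto
  then have E [measurable]: "E \<in> sets borel"
    by (simp add: E_def)
  have zero: "(\<integral>\<^sup>+ p. indicator E (gauss_branch (Suc i) p) * ennreal (1 / (fst p - snd p + Suc i) ^ 3) *
      indicator {p. fst p - 1 \<le> snd p \<and> snd p \<le> fst p} p \<partial>lborel) = 0" (is "(\<integral>\<^sup>+ p. ?F p \<partial>lborel) = 0") for i
  proof -
    have vanish: "?F p = 0" if p: "p \<notin> S" "p \<notin> rational_lines" for p
    proof (rule ccontr)
      assume "?F p \<noteq> 0"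
      then have *: "gauss_branch (Suc i) p \<in> E" "fst p - 1 \<le> snd p" "snd p \<le> fst p"
        by (auto simp: indicator_def split: if_splits)
      have "fst p - snd p \<noteq> 1"
        using rational_linesI[of 1 "fst p" "- 1" "snd p" 1] p(2) by auto
      then have "G (gauss_branch (Suc i) p) = p"
        using * G_gauss_branch[of "fst p" "snd p" "Suc i"] by auto
      then show False
        using * p(1) by (simp add: E_def)
    qed
    have "AE p in lborel. ?F p = 0"
      using AE_not_in[OF S] AE_not_in[OF null_sets_rational_lines] by eventually_elim (rule vanish)
    then show ?thesis
      by (rule trans[OF nn_integral_cong_AE]) simp
  qed
  have "emeasure lborel E = (\<integral>\<^sup>+ p. indicator E p \<partial>lborel)"
    by simp
  also have "\<dots> \<le> (\<Sum>i. \<integral>\<^sup>+ p. indicator E (gauss_branch (Suc i) p) * ennreal (1 / (fst p - snd p + Suc i) ^ 3) *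
      indicator {p. fst p - 1 \<le> snd p \<and> snd p \<le> fst p} p \<partial>lborel)"
    by (rule nn_integral_le_sum_gauss_branches, measurable)
       (auto simp: E_def interior_U indicator_def split: if_splits)
  also have "\<dots> = 0"
    unfolding zero by simp
  finally show ?thesis
    using E by (simp add: null_sets_def E_def)
qed

text \<open>The guard keeps the orbit in \<open>interior U\<close>, where
  \<open>null_sets_vimage_G\<close> controls preimages; \<open>irr\<close> in
  \<open>finite_type_aperiodic_outside_A\<close> carries the same guard.\<close>

lemma null_sets_vimage_funpow_G:
  assumes "S \<in> null_sets lborel"
  shows "{p. (\<forall>i<n. (G ^^ i) p \<in> interior U) \<and> (G ^^ n) p \<in> S} \<in> null_sets lborel"
  using assms
proof (induction n arbitrary: S)
  case (Suc n)
  have "{p. (\<forall>i<Suc n. (G ^^ i) p \<in> interior U) \<and> (G ^^ Suc n) p \<in> S} =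
    {p. (\<forall>i<n. (G ^^ i) p \<in> interior U) \<and> (G ^^ n) p \<in> interior U \<inter> G -` S}"
    by (auto simp: less_Suc_eq)
  then show ?case
    using Suc.IH[OF null_sets_vimage_G[OF Suc.prems]] by simp
qed simp

section \<open>The strictly decreasing density\<close>

definition gauss_density :: "real \<times> real \<Rightarrow> real" where
  "gauss_density = (\<lambda>(u, v). 1 / ((1 + u - v) * (1 - v)))"

text \<open>The contribution of the \<open>k\<close>-th inverse branch to the Perron-Frobenius
  transform of \<open>gauss_density\<close>.\<close>

definition branch_density :: "nat \<Rightarrow> real \<times> real \<Rightarrow> real" where
  "branch_density k = (\<lambda>(u, v). 1 / ((k + u - v) * (k - v) * (k + 1 - v)))"

lemma measurable_gauss_density [measurable]: "gauss_density \<in> borel_measurable borel"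
  unfolding gauss_density_def borel_prod[symmetric] by measurable

lemma measurable_branch_density [measurable]: "branch_density k \<in> borel_measurable borel"
  unfolding branch_density_def borel_prod[symmetric] by measurable

text \<open>At the branch point both factors of the density have denominator \<open>d\<close>, which
  cancels two of the three powers in the Jacobian.\<close>

lemma gauss_density_branch:
  assumes "(u, v) \<in> interior U" "k \<ge> 1"
  shows "gauss_density (gauss_branch k (u, v)) * (1 / (u - v + real k) ^ 3) = branch_density k (u, v)"
proof -
  define d where "d = u - v + real k"
  have "d > 0" "real k - v > 0" "u = d + v - real k"
    using assms by (auto simp: d_def interior_U)
  moreover have "1 + 1 / d - u / d = (real k + 1 - v) / d" "1 - u / d = (real k - v) / d"
    using \<open>d > 0\<close> \<open>u = d + v - real k\<close> by (simp_all add: diff_divide_distrib add_divide_distrib)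
  moreover have "real k + u - v = d"
    by (simp add: d_def)
  ultimately show ?thesis
    by (simp add: gauss_density_def gauss_branch_def branch_density_def d_def[symmetric] power3_eq_cube)
qed

text \<open>Bounding the first factor \<open>k + u - v\<close> below by \<open>1 + u - v\<close> turns the sum into a
  telescoping one with value \<open>gauss_density\<close>; the loss is strict for \<open>k = 2\<close>.\<close>

lemma sum_branch_density_less:
  assumes "(u, v) \<in> interior U"
  shows "(\<Sum>i. ennreal (branch_density (Suc i) (u, v))) < ennreal (gauss_density (u, v))"
proof -
  have uv: "0 < v" "v < u" "u < 1"
    using assms by (auto simp: interior_U)
  \<comment> \<open>Partial fractions of \<open>1 / ((i + 1 - v) * (i + 2 - v))\<close>.\<close>
  define t where "t i = (1 / (1 + u - v)) * (1 / (real i + 1 - v))" for i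
  have "(\<lambda>i. 1 / (real i + 1 - v)) \<longlonglongrightarrow> 0"
    by real_asymp
  then have "t \<longlonglongrightarrow> 0"
    unfolding t_def by (rule tendsto_mult_right_zero)
  then have t_sums: "(\<lambda>i. t i - t (Suc i)) sums gauss_density (u, v)"
    using telescope_sums'[of t 0] by (simp add: t_def gauss_density_def)
  have t_diff: "t i - t (Suc i) = 1 / ((1 + u - v) * (real i + 1 - v) * (real i + 2 - v))" for i
    using uv by (simp add: t_def divide_simps)
  have pos: "0 \<le> branch_density (Suc i) (u, v)" for i
    using uv by (simp add: branch_density_def)
  have le: "branch_density (Suc i) (u, v) \<le> t i - t (Suc i)" for i
    unfolding t_diff branch_density_def using uv
    by (simp add: add_ac) (intro divide_left_mono mult_right_mono mult_pos_pos; simp)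
  \<comment> \<open>Index 0, that is \<open>k = 1\<close>, gives equality; index 1 is the first
    strict one.\<close>
  have less: "branch_density (Suc 1) (u, v) < t 1 - t (Suc 1)"
    unfolding t_diff branch_density_def using uv
    by (simp add: add_ac) (intro divide_strict_left_mono mult_strict_right_mono mult_pos_pos; simp)
  have summable: "summable (\<lambda>i. branch_density (Suc i) (u, v))"
    by (rule summable_comparison_test'[OF sums_summable[OF t_sums], of 0]) (use pos le in auto)
  have "0 < (\<Sum>i. (t i - t (Suc i)) - branch_density (Suc i) (u, v))"
    using le less
    by (intro suminf_pos2[OF summable_diff[OF sums_summable[OF t_sums] summable], of 1]) auto
  also have "\<dots> = gauss_density (u, v) - (\<Sum>i. branch_density (Suc i) (u, v))"
    using summable sums_unique[OF t_sums] sums_summable[OF t_sums] by (simp add: suminf_diff[symmetric])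
  finally have "(\<Sum>i. branch_density (Suc i) (u, v)) < gauss_density (u, v)"
    by simp
  then show ?thesis
    using pos summable by (simp add: suminf_ennreal2 ennreal_less_iff suminf_nonneg)
qed

text \<open>For fixed \<open>b\<close> the density is at most \<open>1 / (1 - b)\<close> on a
  section of length \<open>1 - b\<close>, so integrating over \<open>a\<close> first cancels the
  singularity at \<open>b = 1\<close>.\<close>

lemma nn_integral_gauss_density_finite:
  "(\<integral>\<^sup>+ p. ennreal (gauss_density p) * indicator (interior U) p \<partial>lborel) < \<infinity>"
proof -
  have [measurable]: "interior U \<in> sets (borel \<Otimes>\<^sub>M borel)"
    unfolding borel_prod by (intro borel_open open_interior)
  have [measurable]: "gauss_density \<in> borel_measurable (borel \<Otimes>\<^sub>M borel)"
    by (simp add: borel_prod)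
  have "(\<integral>\<^sup>+ a. ennreal (gauss_density (a, b)) * indicator (interior U) (a, b) \<partial>lborel) \<le> indicator {0..1} b" for b
  proof (cases "0 < b \<and> b < 1")
    case True
    have "gauss_density (a, b) \<le> 1 / (1 - b)" if "b < a" for a
      using that True mult_right_mono[of 1 "1 + a - b" "1 - b"]
      by (auto simp: gauss_density_def intro!: divide_left_mono)
    then have "(\<integral>\<^sup>+ a. ennreal (gauss_density (a, b)) * indicator (interior U) (a, b) \<partial>lborel) \<le>
      (\<integral>\<^sup>+ a. ennreal (1 / (1 - b)) * indicator {b..1} a \<partial>lborel)"
      by (intro nn_integral_mono) (auto simp: interior_U indicator_def intro!: ennreal_leI)
    also have "\<dots> = ennreal (1 / (1 - b)) * ennreal (1 - b)"
      using True by (subst nn_integral_cmult_indicator) auto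
    also have "\<dots> = 1"
      using True by (simp add: ennreal_mult[symmetric])
    finally show ?thesis
      using True by simp
  next
    case False
    then have "indicator (interior U) (a, b) = (0 :: ennreal)" for a
      by (auto simp: interior_U)
    then show ?thesis by simp
  qed
  then have "(\<integral>\<^sup>+ b. \<integral>\<^sup>+ a. ennreal (gauss_density (a, b)) * indicator (interior U) (a, b) \<partial>lborel \<partial>lborel) \<le>
      (\<integral>\<^sup>+ b. indicator {0..1::real} b \<partial>lborel)"
    by (intro nn_integral_mono)
  also have "\<dots> < \<infinity>"
    by simp
  also have "(\<integral>\<^sup>+ b. \<integral>\<^sup>+ a. ennreal (gauss_density (a, b)) * indicator (interior U) (a, b) \<partial>lborel \<partial>lborel) =
      (\<integral>\<^sup>+ p. ennreal (gauss_density p) * indicator (interior U) p \<partial>lborel)"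
    by (subst nn_integral_lborel_prod, simp, subst lborel_pair.Fubini') measurable
  finally show ?thesis .
qed

section \<open>Measure zero of \<open>A\<close> and the conclusion\<close>

lemma A_subset_interior: "A \<subseteq> interior U"
proof
  fix p assume "p \<in> A"
  then have "(G ^^ 0) p \<in> interior U"
    unfolding A_def by blast
  then show "p \<in> interior U" by simp
qed

lemma G_in_A:
  assumes "p \<in> A"
  shows "G p \<in> A"
  unfolding A_def
proof (intro INT_I vimageI2)
  fix n
  have "(G ^^ Suc n) p \<in> interior U"
    using assms unfolding A_def by blast
  then show "(G ^^ n) (G p) \<in> interior U"
    by (simp add: funpow_swap1)
qed

lemma null_sets_A: "A \<in> null_sets lborel"
proof (rule ccontr)
  assume "A \<notin> null_sets lborel"
  then have notnull: "\<not> (AE p in lborel. p \<notin> A)"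
    using AE_iff_null_sets[of A lborel] by simp
  \<comment> \<open>The transform of the density, cut off to \<open>A\<close>.\<close>
  define P where "P p = (\<Sum>i. ennreal (branch_density (Suc i) p) * indicator A p)" for p
  have [measurable]: "P \<in> borel_measurable borel"
    unfolding P_def by measurable
  have P_less: "P p < ennreal (gauss_density p)" if "p \<in> A" for p
    using that sum_branch_density_less[of "fst p" "snd p"] A_subset_interior by (auto simp: P_def)
  have P_0: "P p = 0" if "p \<notin> A" for p
    using that by (simp add: P_def)
  have step: "ennreal (gauss_density (gauss_branch (Suc i) p)) * indicator A (gauss_branch (Suc i) p) *
      ennreal (1 / (fst p - snd p + Suc i) ^ 3) * indicator {p. fst p - 1 \<le> snd p \<and> snd p \<le> fst p} p
      \<le> ennreal (branch_density (Suc i) p) * indicator A p" for i p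
  proof (cases "gauss_branch (Suc i) p \<in> A \<and> fst p - 1 \<le> snd p \<and> snd p \<le> fst p")
    case True
    obtain u v where p: "p = (u, v)" by fastforce
    have "G (gauss_branch (Suc i) p) \<in> A"
      using True G_in_A by blast
    \<comment> \<open>On the edge, \<open>G\<close> would send the branch point to the diagonal,
      which \<open>A\<close> does not meet.\<close>
    moreover from this have "v \<noteq> u - 1"
      using G_gauss_branch_edge[of v u "Suc i"] A_subset_interior by (auto simp: p interior_U)
    ultimately have "(u, v) \<in> A"
      using True G_gauss_branch[of u v "Suc i"] by (auto simp: p)
    moreover have "0 \<le> 1 / (u - v + real (Suc i)) ^ 3"
      using True by (simp add: p)
    ultimately show ?thesis
      using True gauss_density_branch[of u v "Suc i"] A_subset_interior
      by (auto simp: p ennreal_mult''[symmetric] simp del: of_nat_Suc)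
  qed (auto simp: indicator_def)
  have "(\<integral>\<^sup>+ p. ennreal (gauss_density p) * indicator A p \<partial>lborel) \<le>
    (\<Sum>i. \<integral>\<^sup>+ p. ennreal (gauss_density (gauss_branch (Suc i) p)) * indicator A (gauss_branch (Suc i) p) *
      ennreal (1 / (fst p - snd p + Suc i) ^ 3) * indicator {p. fst p - 1 \<le> snd p \<and> snd p \<le> fst p} p \<partial>lborel)"
    using A_subset_interior
    by (intro nn_integral_le_sum_gauss_branches) (auto simp: indicator_def interior_U split: if_splits)
  also have "\<dots> \<le> (\<Sum>i. \<integral>\<^sup>+ p. ennreal (branch_density (Suc i) p) * indicator A p \<partial>lborel)"
    by (intro suminf_le nn_integral_mono step) auto
  also have "\<dots> = (\<integral>\<^sup>+ p. P p \<partial>lborel)"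
    unfolding P_def by (intro nn_integral_suminf[symmetric]) measurable
  finally have ge: "(\<integral>\<^sup>+ p. ennreal (gauss_density p) * indicator A p \<partial>lborel) \<le> (\<integral>\<^sup>+ p. P p \<partial>lborel)" .
  have le: "P p \<le> ennreal (gauss_density p) * indicator A p" for p
    using P_less[of p] P_0[of p] by (cases "p \<in> A") auto
  \<comment> \<open>Finiteness is what turns the pointwise strict inequality on a non-null set into
    a strict inequality of integrals, contradicting \<open>ge\<close>.\<close>
  have "(\<integral>\<^sup>+ p. P p \<partial>lborel) \<le> (\<integral>\<^sup>+ p. ennreal (gauss_density p) * indicator (interior U) p \<partial>lborel)"
    using A_subset_interior by (intro nn_integral_mono order_trans[OF le]) (auto simp: indicator_def)
  then have "(\<integral>\<^sup>+ p. P p \<partial>lborel) \<noteq> \<infinity>"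
    using nn_integral_gauss_density_finite by auto
  moreover have "\<not> (AE p in lborel. ennreal (gauss_density p) * indicator A p \<le> P p)"
  proof
    assume "AE p in lborel. ennreal (gauss_density p) * indicator A p \<le> P p"
    then have "AE p in lborel. p \<notin> A"
      by (rule eventually_mono) (metis P_less indicator_simps(1) mult.right_neutral not_le)
    then show False using notnull by simp
  qed
  ultimately have "(\<integral>\<^sup>+ p. P p \<partial>lborel) < (\<integral>\<^sup>+ p. ennreal (gauss_density p) * indicator A p \<partial>lborel)"
    using le by (intro nn_integral_less) auto
  then show False using ge by simp
qed

theorem theorem6:
  shows "A \<in> null_sets lebesgue \<and>
    (AE (\<alpha>, \<beta>) in lebesgue. (\<alpha>, \<beta>) \<in> U \<longrightarrow> finite_type \<alpha> \<beta> \<and> aperiodic \<alpha> \<beta>)"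
proof
  show "A \<in> null_sets lebesgue"
    by (rule null_sets_completionI[OF null_sets_A])
  \<comment> \<open>Only countably many exit times occur, so the exceptional sets can be discarded
    together.\<close>
  have "AE p in lborel. \<forall>n. \<not> ((\<forall>i<n. (G ^^ i) p \<in> interior U) \<and> (G ^^ n) p \<in> rational_lines)"
    unfolding AE_all_countable
    using AE_not_in[OF null_sets_vimage_funpow_G[OF null_sets_rational_lines]] by simp
  with AE_not_in[OF null_sets_A]
  have "AE p in lborel. p \<in> U \<longrightarrow> (case p of (\<alpha>, \<beta>) \<Rightarrow> finite_type \<alpha> \<beta> \<and> aperiodic \<alpha> \<beta>)"
    by eventually_elim (use finite_type_aperiodic_outside_A in blast)
  then show "AE (\<alpha>, \<beta>) in lebesgue. (\<alpha>, \<beta>) \<in> U \<longrightarrow> finite_type \<alpha> \<beta> \<and> aperiodic \<alpha> \<beta>"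
    by (intro AE_completion) (auto simp: case_prod_beta elim: eventually_mono)
qed

end
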